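(* Let $L, X, X' \subset \mathbb{R}^d$ be finite nonempty sets. Then for every $i \in \mathbb{N}$, $$d_B\big(\mathrm{dgm}_i(\mathrm{Flood}(X,L)),\ \mathrm{dgm}_i(\mathrm{Flood}(X',L))\big) \le d_H(X,X').$$
   Context: $d(\cdot,\cdot)$ is the Euclidean metric on $\mathbb{R}^d$, $B_r(x)=\{y\in\mathbb{R}^d : d(x,y)\le r\}$, and $\mathrm{conv}(\sigma)$ is the convex hull of $\sigma$. $\mathbb{N}$ includes $0$. $\mathrm{Del}(L)$ denotes the Delaunay complex (Delaunay triangulation) of $L$, viewed as an abstract simplicial complex on the vertex set $L$; if the Delaunay triangulation of $L$ is not unique, one is fixed and the same one is used throughout. Flood complex: for $r\ge 0$, $\mathrm{Flood}_r(X,L)=\{\sigma\in \mathrm{Del}(L) : \mathrm{conv}(\sigma)\subset \bigcup_{x\in X}B_r(x)\}$. This is a simplicial complex, increasing in $r$, and $\mathrm{Flood}(X,L)$ denotes the filtered simplicial complex $\{\mathrm{Flood}_r(X,L)\}_{r\in[0,\infty)}$. $\mathrm{dgm}_i$ of a filtered simplicial complex denotes its $i$-th persistence diagram (homology $H_i$ with coefficients in a fixed field), i.e. the multiset of (birth, death) pairs, with death possibly $\infty$. The bottleneck distance is $d_B(D_1,D_2)=\inf_{\eta}\sup_{p\in D_1}\|p-\eta(p)\|_\infty$, the infimum being over all bijections $\eta:D_1\to D_2$, where every diagonal point $(b,b)$ is included in each diagram with infinite multiplicity. $d_H$ is the (symmetric) Hausdorff distance, $d_H(X,X')=\max\{\max_{x\in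 X}\min_{x'\in X'}d(x,x'),\ \max_{x'\in X'}\min_{x\in X}d(x,x')\}$. *)

theory Defs
  imports "HOL-Analysis.Analysis"
begin

section \<open>Delaunay triangulations and the Flood complex\<close>

text \<open>
  Abstract simplicial complexes are sets of nonempty finite vertex sets. No general position is
  assumed, so a Delaunay triangulation of \<open>L\<close> need not be unique: the predicate below singles out
  the triangulations \<open>D\<close> of the convex hull of \<open>L\<close>, with vertex set \<open>L\<close>, in which every simplex
  has a circumscribing sphere whose open ball contains no point of \<open>L\<close>. The constant
  \<^const>\<open>triangulation\<close> says that the geometric simplices meet in common faces.
\<close>

definition delaunay_triangulation :: "'a::euclidean_space set \<Rightarrow> 'a set set \<Rightarrow> bool" where
  "delaunay_triangulation L D \<longleftrightarrow>
     (\<forall>\<sigma>\<in>D. \<sigma> \<noteq> {} \<and> \<sigma> \<subseteq> L \<and> \<not> affine_dependent \<sigma>) \<and>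
     (\<forall>\<sigma>\<in>D. \<forall>\<tau>. \<tau> \<noteq> {} \<and> \<tau> \<subseteq> \<sigma> \<longrightarrow> \<tau> \<in> D) \<and>
     (\<forall>v\<in>L. {v} \<in> D) \<and>
     triangulation ((\<lambda>\<sigma>. convex hull \<sigma>) ` D) \<and>
     (\<Union>\<sigma>\<in>D. convex hull \<sigma>) = convex hull L \<and>
     (\<forall>\<sigma>\<in>D. \<exists>z \<rho>. \<sigma> \<subseteq> sphere z \<rho> \<and> L \<inter> ball z \<rho> = {})"

text \<open>
  The second argument is the chosen Delaunay triangulation of \<open>L\<close>. The filtration is only of
  interest for \<open>r \<ge> 0\<close>; for \<open>r < 0\<close> the balls are empty and hence so is the complex.
\<close>

definition flood :: "'a::euclidean_space set \<Rightarrow> 'a set set \<Rightarrow> real \<Rightarrow> 'a set set" where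
  "flood X D r = {\<sigma> \<in> D. convex hull \<sigma> \<subseteq> (\<Union>x\<in>X. cball x r)}"


section \<open>Simplicial homology with coefficients in a field\<close>

text \<open>
  An oriented \<open>i\<close>-chain of \<open>K\<close> is an alternating function on the orderings \<open>[v\<^sub>0, \<dots>, v\<^sub>i]\<close> of the
  \<open>i\<close>-simplices of \<open>K\<close>: its value is the coefficient of that oriented simplex, and
  exchanging two vertices reverses the orientation and thus the sign.
\<close>

definition chains :: "nat \<Rightarrow> 'a set set \<Rightarrow> ('a list \<Rightarrow> 'k::field) set" where
  "chains i K = {c.
     (\<forall>vs. c vs \<noteq> 0 \<longrightarrow> length vs = Suc i \<and> distinct vs \<and> set vs \<in> K) \<and>
     (\<forall>vs j k. j < length vs \<and> k < length vs \<and> j \<noteq> k \<longrightarrow>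
        c (vs[j := vs ! k, k := vs ! j]) = - c vs)}"

text \<open>
  In the usual boundary \<open>\<partial>[v\<^sub>0, \<dots>, v\<^sub>i] = (\<Sum>j. (-1)^j [v\<^sub>0, \<dots>, v\<^sub>j\<^sub>-\<^sub>1, v\<^sub>j\<^sub>+\<^sub>1, \<dots>, v\<^sub>i])\<close> an
  oriented simplex \<open>vs\<close> occurs as a face of each \<open>v # vs\<close> with sign \<open>+1\<close>, so its coefficient in
  \<open>\<partial>c\<close> is the sum of the \<open>c (v # vs)\<close>. The value at the empty list is \<open>0\<close>
  because the homology is not reduced.
\<close>

definition boundary :: "('a list \<Rightarrow> 'k::field) \<Rightarrow> 'a list \<Rightarrow> 'k" where
  "boundary c vs = (if vs = [] then 0 else (\<Sum>v | c (v # vs) \<noteq> 0. c (v # vs)))"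

definition cycles :: "nat \<Rightarrow> 'a set set \<Rightarrow> ('a list \<Rightarrow> 'k::field) set" where
  "cycles i K = {c \<in> chains i K. boundary c = (\<lambda>vs. 0)}"

definition boundaries :: "nat \<Rightarrow> 'a set set \<Rightarrow> ('a list \<Rightarrow> 'k::field) set" where
  "boundaries i K = boundary ` chains (Suc i) K"

text \<open>The class of a cycle \<open>z\<close> in \<open>H\<^sub>i(K)\<close>, cycles modulo boundaries, as a coset.\<close>

definition homology_class ::
    "nat \<Rightarrow> 'a set set \<Rightarrow> ('a list \<Rightarrow> 'k::field) \<Rightarrow> ('a list \<Rightarrow> 'k) set" where
  "homology_class i K z = {w \<in> cycles i K. (\<lambda>vs. w vs - z vs) \<in> boundaries i K}"


section \<open>Persistence diagrams\<close>

text \<open>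
  For \<open>K \<subseteq> K'\<close> this is the rank of the map \<open>H\<^sub>i(K) \<rightarrow> H\<^sub>i(K')\<close> induced by inclusion, over the
  field \<open>'k\<close>: the largest number of cycles of \<open>K\<close> whose classes in \<open>H\<^sub>i(K')\<close> are linearly
  independent.
\<close>

definition persistent_betti :: "'k::field itself \<Rightarrow> nat \<Rightarrow> 'a set set \<Rightarrow> 'a set set \<Rightarrow> nat" where
  "persistent_betti (_ :: 'k itself) i K K' =
     Max {n. \<exists>z :: nat \<Rightarrow> 'a list \<Rightarrow> 'k.
       (\<forall>j<n. z j \<in> cycles i K) \<and>
       (\<forall>a. homology_class i K' (\<lambda>vs. \<Sum>j<n. a j * z j vs) = homology_class i K' (\<lambda>vs. 0)
          \<longrightarrow> (\<forall>j<n. a j = 0))}"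

text \<open>
  A persistence diagram is represented by the multiplicities of its points \<open>(b, d)\<close>, \<open>b < d\<close>,
  off the diagonal. The number of independent classes born at \<open>b\<close> and dying at \<open>d\<close> is, with
  \<open>\<beta> r s\<close> the rank of \<open>H\<^sub>i(F r) \<rightarrow> H\<^sub>i(F s)\<close>, the value
  \<open>\<beta> (b + \<epsilon>) (d - \<epsilon>) - \<beta> (b - \<epsilon>) (d - \<epsilon>) - \<beta> (b + \<epsilon>) (d + \<epsilon>) + \<beta> (b - \<epsilon>) (d + \<epsilon>)\<close>
  attained for all small \<open>\<epsilon> > 0\<close>; for \<open>d = \<infinity>\<close> it is the value
  \<open>\<beta> (b + \<epsilon>) s - \<beta> (b - \<epsilon>) s\<close> attained for small \<open>\<epsilon>\<close> and large \<open>s\<close>.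
  These values are eventually constant for a filtration of a finite complex.
\<close>

definition dgm :: "'k::field itself \<Rightarrow> nat \<Rightarrow> (real \<Rightarrow> 'a set set) \<Rightarrow> real \<times> ereal \<Rightarrow> nat" where
  "dgm k i F = (\<lambda>(b, d).
     let \<beta> = (\<lambda>r s. int (persistent_betti k i (F r) (F s))) in
     if \<not> ereal b < d then 0
     else if d = \<infinity> then
       (THE n. \<forall>\<^sub>F \<epsilon> in at_right 0. \<forall>\<^sub>F s in at_top.
          int n = \<beta> (b + \<epsilon>) s - \<beta> (b - \<epsilon>) s)
     else
       (THE n. \<forall>\<^sub>F \<epsilon> in at_right 0.
          let d' = real_of_ereal d in
          int n = \<beta> (b + \<epsilon>) (d' - \<epsilon>) - \<beta> (b - \<epsilon>) (d' - \<epsilon>)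
                - \<beta> (b + \<epsilon>) (d' + \<epsilon>) + \<beta> (b - \<epsilon>) (d' + \<epsilon>)))"


section \<open>Bottleneck and Hausdorff distance\<close>

text \<open>The case distinction gives distance \<open>0\<close> to \<open>\<infinity>\<close> from itself, whereas \<open>\<bar>\<infinity> - \<infinity>\<bar> = \<infinity>\<close>.\<close>

definition ereal_dist :: "ereal \<Rightarrow> ereal \<Rightarrow> ereal" where
  "ereal_dist x y = (if x = y then 0 else \<bar>x - y\<bar>)"

definition linf_dist :: "real \<times> ereal \<Rightarrow> real \<times> ereal \<Rightarrow> ereal" where
  "linf_dist p q = max (ereal \<bar>fst p - fst q\<bar>) (ereal_dist (snd p) (snd q))"

text \<open>
  The points of a diagram, each tagged with an index to tell apart its copies, together with
  infinitely many copies of every diagonal point.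
\<close>

definition dgm_points :: "(real \<times> ereal \<Rightarrow> nat) \<Rightarrow> ((real \<times> ereal) \<times> nat) set" where
  "dgm_points m = {(p, n). n < m p} \<union> {((b, ereal b), n) | b n. True}"

definition bottleneck :: "(real \<times> ereal \<Rightarrow> nat) \<Rightarrow> (real \<times> ereal \<Rightarrow> nat) \<Rightarrow> ereal" where
  "bottleneck m m' =
     (INF \<eta> \<in> {\<eta>. bij_betw \<eta> (dgm_points m) (dgm_points m')}.
        SUP p \<in> dgm_points m. linf_dist (fst p) (fst (\<eta> p)))"

definition hausdorff_dist :: "'a::metric_space set \<Rightarrow> 'a set \<Rightarrow> real" where
  "hausdorff_dist X X' =
     max (MAX x\<in>X. MIN x'\<in>X'. dist x x') (MAX x'\<in>X'. MIN x\<in>X. dist x x')"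

end

theory Submission
  imports Defs "HOL-Library.Function_Algebras"
begin

text \<open>
  A simplex enters \<open>Flood(X, L)\<close> at the maximum over its convex hull of the distance to \<open>X\<close>,
  and this time changes by at most \<open>d\<^sub>H(X, X')\<close> when \<open>X\<close> is replaced by \<open>X'\<close>. So it suffices
  to compare the sublevel filtrations of two functions \<open>f\<close>, \<open>g\<close> on one finite complex. If \<open>f\<close>
  and \<open>g\<close> never order two simplices oppositely, a single filtration with index set
  \<open>{0, \<dots>, m}\<close> induces both; its interval multiplicities, the second differences
  of the ranks \<open>dim Z\<^sub>j - dim (Z\<^sub>j \<inter> B\<^sub>k)\<close>, are nonnegative and are pushed forward to both
  diagrams, which matches an interval \<open>(j, k)\<close> at \<open>(f\<^sub>j, f\<^sub>k)\<close> with itself at \<open>(g\<^sub>j, g\<^sub>k)\<close>. In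
  general, one follows the segment from \<open>f\<close> to \<open>g\<close> up to the first time at which two oppositely
  ordered simplices meet, and proceeds by induction on the number of such pairs; the costs of the
  pieces add up to \<open>\<parallel>f - g\<parallel>\<close>.
\<close>


section \<open>Relative dimensions of subspaces\<close>

context vector_space
begin

text \<open>A vanishing combination splits into a part over \<open>A\<close> and a part over
  \<open>B\<close>. They are negatives of each other, so both lie in the trivial intersection of the
  spans and vanish separately.\<close>

lemma independent_Un_trivial_Int:
  assumes A: "independent A" and B: "independent B" and AB: "span A \<inter> span B \<subseteq> {0}"
  shows "independent (A \<union> B)" and "A \<inter> B = {}"
proof -
  show disj: "A \<inter> B = {}"
  proof -
    have "x \<noteq> 0" if "x \<in> A" for x
      using A dependent_zero that by blast
    then show ?thesis
      using AB span_base by blast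
  qed
  show "independent (A \<union> B)"
    unfolding independent_explicit_module
  proof (intro allI impI)
    fix t u v
    assume t: "finite t" "t \<subseteq> A \<union> B" and eq: "(\<Sum>v\<in>t. scale (u v) v) = 0" and v: "v \<in> t"
    let ?a = "\<Sum>v\<in>t \<inter> A. scale (u v) v" and ?b = "\<Sum>v\<in>t \<inter> B. scale (u v) v"
    have "t = (t \<inter> A) \<union> (t \<inter> B)" using t by auto
    then have "(\<Sum>v\<in>t. scale (u v) v) = ?a + ?b"
      using sum.union_disjoint[of "t \<inter> A" "t \<inter> B" "\<lambda>v. scale (u v) v"] t disj by fastforce
    then have sum0: "?a + ?b = 0" using eq by simp
    have "?a \<in> span A" by (rule span_sum) (simp add: span_scale span_base)
    moreover have "?b \<in> span B" by (rule span_sum) (simp add: span_scale span_base)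
    then have "- ?b \<in> span B" by (rule span_neg)
    moreover have "?a = - ?b" using sum0 by (simp only: eq_neg_iff_add_eq_0)
    ultimately have "?a \<in> span A \<inter> span B" by simp
    with AB have a0: "?a = 0" by (simp only: subset_iff singleton_iff)
    with sum0 have b0: "?b = 0" by simp
    show "u v = 0"
    proof (cases "v \<in> A")
      case True
      with t v show ?thesis by (intro independentD[OF A _ _ a0]) auto
    next
      case False
      with t v show ?thesis by (intro independentD[OF B _ _ b0]) auto
    qed
  qed
qed

text \<open>The coordinates of a common vector with respect to \<open>B\<close> are supported both
  in \<open>C\<close> and outside \<open>C\<close>, so all of them vanish.\<close>

lemma span_Int_span_Diff:
  assumes B: "independent B" and C: "C \<subseteq> B"
  shows "span C \<inter> span (B - C) \<subseteq> {0}"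
proof
  fix x assume "x \<in> span C \<inter> span (B - C)"
  then have x: "x \<in> span C" "x \<in> span (B - C)" by auto
  have "representation B x = representation C x"
    using representation_extend[OF B x(1) C] .
  moreover have "representation B x = representation (B - C) x"
    using representation_extend[OF B x(2)] by blast
  ultimately have rep: "representation B x b = 0" for b
    using representation_ne_zero[of C x b] representation_ne_zero[of "B - C" x b] by auto
  have "x \<in> span B" using x C span_mono by blast
  then show "x \<in> {0}"
    using sum_nonzero_representation_eq[OF B, of x] by (simp add: rep)
qed

lemma basis_exists_finite:
  assumes "subspace V" "V \<subseteq> span T" "finite T"
  obtains B where "independent B" "finite B" "span B = V" "card B = dim V"
proof -
  obtain B where B: "B \<subseteq> V" "independent B" "V \<subseteq> span B" "card B = dim V"
    using basis_exists by blast
  moreover have "finite B"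
    using independent_span_bound[of T B] B assms by blast
  moreover have "span B = V" using B assms span_subspace by blast
  ultimately show ?thesis using that by blast
qed

text \<open>A basis \<open>C\<close> of \<open>U \<inter> W\<close> is extended to a basis of
  \<open>U\<close>; the added vectors form \<open>E\<close>. A vector of
  \<open>span E \<inter> W\<close> lies in \<open>U \<inter> W = span C\<close>, hence is
  zero.\<close>

lemma complement_basis_exists:
  assumes U: "subspace U" "U \<subseteq> span T" "finite T" and W: "subspace W"
  obtains E where "independent E" "finite E" "E \<subseteq> U" "span E \<inter> W \<subseteq> {0}"
    "card E + dim (U \<inter> W) = dim U"
proof -
  obtain C where C: "independent C" "finite C" "span C = U \<inter> W" "card C = dim (U \<inter> W)"
    using basis_exists_finite[of "U \<inter> W" T] U W subspace_inter by blast
  have "C \<subseteq> U" using C(3) span_superset by blast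
  then obtain B where B: "C \<subseteq> B" "B \<subseteq> U" "independent B" "U \<subseteq> span B"
    using maximal_independent_subset_extend[OF _ C(1)] by metis
  have fB: "finite B" using independent_span_bound[of T B] B U by blast
  have "card B = dim U" using basis_card_eq_dim B by blast
  moreover have "card B = card (B - C) + card C"
    using fB B(1) by (metis card_Diff_subset card_mono finite_subset le_add_diff_inverse2)
  ultimately have card: "card (B - C) + dim (U \<inter> W) = dim U" using C by simp
  have "span (B - C) \<subseteq> U" using B U span_minimal[of "B - C" U] by blast
  then have "span (B - C) \<inter> W \<subseteq> {0}"
    using span_Int_span_Diff[OF B(3,1)] C(3) by blast
  moreover have "independent (B - C)" using B(3) by (rule independent_mono) blast
  moreover have "B - C \<subseteq> U" using B(2) by blast
  ultimately show ?thesis using fB card that[of "B - C"] by simp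
qed

text \<open>The inequality half of the Grassmann formula: a complement of
  \<open>U \<inter> W\<close> in \<open>U\<close>, joined with a basis of \<open>W\<close>, stays
  independent inside \<open>V\<close>.\<close>

lemma dim_add_dim_le:
  assumes U: "subspace U" "U \<subseteq> V" and W: "subspace W" "W \<subseteq> V"
    and V: "subspace V" "V \<subseteq> span T" "finite T"
  shows "dim U + dim W \<le> dim V + dim (U \<inter> W)"
proof -
  obtain E where E: "independent E" "finite E" "E \<subseteq> U" "span E \<inter> W \<subseteq> {0}"
      "card E + dim (U \<inter> W) = dim U"
    using complement_basis_exists[of U T W] U V W by blast
  obtain A where A: "independent A" "finite A" "span A = W" "card A = dim W"
    using basis_exists_finite[of W T] U V W by blast
  have ind: "independent (E \<union> A)" and disj: "E \<inter> A = {}"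
    using independent_Un_trivial_Int[of E A] E A by auto
  obtain B where B: "independent B" "finite B" "span B = V" "card B = dim V"
    using basis_exists_finite[of V T] V by blast
  have "E \<union> A \<subseteq> span B" using B E(3) A(3) U W span_superset[of A] by blast
  then have "card (E \<union> A) \<le> dim V"
    using independent_span_bound[OF B(2) ind] B by simp
  then show ?thesis using E A disj by (simp add: card_Un_disjoint)
qed

lemma dim_Int_le:
  assumes "subspace U" "U \<subseteq> span T" "finite T" "subspace W"
  shows "dim (U \<inter> W) \<le> dim U"
proof -
  obtain E where "independent E" "finite E" "E \<subseteq> U" "span E \<inter> W \<subseteq> {0}"
    "card E + dim (U \<inter> W) = dim U"
    by (rule complement_basis_exists[OF assms])
  then show ?thesis by simp
qed

text \<open>Rank-nullity for the map from \<open>Z\<close> to the quotient by \<open>B\<close>,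
  phrased without quotients. A family independent modulo \<open>B\<close> spans a subspace meeting
  \<open>Z \<inter> B\<close> trivially, which bounds \<open>n\<close>; a complement basis of
  \<open>Z \<inter> B\<close> in \<open>Z\<close> attains the bound.\<close>

lemma Max_independent_modulo:
  assumes Z: "subspace Z" "Z \<subseteq> span T" "finite T" and B: "subspace B"
  shows "Max {n. \<exists>z :: nat \<Rightarrow> 'b. (\<forall>j<n. z j \<in> Z) \<and>
           (\<forall>a. (\<Sum>j<n. scale (a j) (z j)) \<in> B \<longrightarrow> (\<forall>j<n. a j = 0))} = dim Z - dim (Z \<inter> B)"
    (is "Max {n. ?P n} = _")
proof (rule Max_eqI)
  have le: "n + dim (Z \<inter> B) \<le> dim Z" if n: "?P n" for n
  proof -
    obtain z :: "nat \<Rightarrow> 'b" where zZ: "\<And>j. j < n \<Longrightarrow> z j \<in> Z"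
      and zB: "\<And>a j. (\<Sum>j<n. scale (a j) (z j)) \<in> B \<Longrightarrow> j < n \<Longrightarrow> a j = 0"
      using n by blast
    have inj: "inj_on z {..<n}"
    proof (rule inj_onI)
      fix k l assume kl: "k \<in> {..<n}" "l \<in> {..<n}" "z k = z l"
      show "k = l"
      proof (rule ccontr)
        assume "k \<noteq> l"
        \<comment> \<open>A repeated vector gives the relation \<open>z k - z l = 0\<close>, whose
          value lies in \<open>B\<close> although its coefficients do not vanish.\<close>
        let ?a = "\<lambda>j. if j = k then 1 else if j = l then -1 else (0::'a)"
        have "(\<Sum>j<n. scale (?a j) (z j)) = (\<Sum>j\<in>{k,l}. scale (?a j) (z j))"
          using kl by (intro sum.mono_neutral_right) auto
        also have "\<dots> = 0" using \<open>k \<noteq> l\<close> kl by simp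
        finally have "?a k = 0" using zB[of ?a k] subspace_0[OF B] kl by simp
        then show False by simp
      qed
    qed
    have re: "(\<Sum>v\<in>z ` {..<n}. scale (u v) v) = (\<Sum>j<n. scale (u (z j)) (z j))" for u
      using inj by (simp add: sum.reindex)
    have ind: "independent (z ` {..<n})"
    proof (rule independent_if_scalars_zero)
      fix u x assume "(\<Sum>v\<in>z ` {..<n}. scale (u v) v) = 0" "x \<in> z ` {..<n}"
      then show "u x = 0" using zB[of "\<lambda>j. u (z j)"] subspace_0[OF B] unfolding re by auto
    qed simp
    have "dim (span (z ` {..<n})) = n"
      using ind inj by (simp add: dim_eq_card_independent card_image)
    moreover have "span (z ` {..<n}) \<inter> (Z \<inter> B) = {0}"
    proof -
      have "x = 0" if "x \<in> span (z ` {..<n})" "x \<in> B" for x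
      proof -
        obtain u where "x = (\<Sum>v\<in>z ` {..<n}. scale (u v) v)"
          using \<open>x \<in> span _\<close> by (auto simp: span_finite)
        then have x: "x = (\<Sum>j<n. scale (u (z j)) (z j))" by (simp add: re)
        then have "\<And>j. j < n \<Longrightarrow> u (z j) = 0"
          using zB[of "\<lambda>j. u (z j)"] \<open>x \<in> B\<close> by blast
        then show ?thesis using x by simp
      qed
      then show ?thesis using Z B subspace_0 span_zero by blast
    qed
    moreover have "span (z ` {..<n}) \<subseteq> Z"
      using zZ Z by (intro span_minimal) auto
    moreover have "dim {0} = 0"
      using dim_span_eq_card_independent[OF independent_empty] by simp
    ultimately show ?thesis
      using dim_add_dim_le[of "span (z ` {..<n})" Z "Z \<inter> B" T] Z B
      by (simp add: subspace_inter)
  qed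
  have "{n. ?P n} \<subseteq> {..dim Z}"
    using le add_leE by blast
  then show "finite {n. ?P n}" by (rule finite_subset) simp
  show "n \<le> dim Z - dim (Z \<inter> B)" if "n \<in> {n. ?P n}" for n
  proof -
    have "n + dim (Z \<inter> B) \<le> dim Z" by (rule le) (use that in simp)
    then show ?thesis by simp
  qed
  obtain E where E: "independent E" "finite E" "E \<subseteq> Z" "span E \<inter> B \<subseteq> {0}"
      "card E + dim (Z \<inter> B) = dim Z"
    using complement_basis_exists[of Z T B] Z B by blast
  obtain z where z: "bij_betw z {..<card E} E"
    using ex_bij_betw_nat_finite[OF E(2)] by (auto simp: atLeast0LessThan)
  have "?P (card E)"
  proof (intro exI[of _ z] conjI allI impI)
    fix j assume "j < card E"
    then show "z j \<in> Z" using z E(3) by (auto simp: bij_betw_def)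
  next
    fix a j assume a: "(\<Sum>j<card E. scale (a j) (z j)) \<in> B" and j: "j < card E"
    \<comment> \<open>Coefficients indexed by numbers are carried to coefficients indexed by the
      vectors of \<open>E\<close>.\<close>
    let ?u = "\<lambda>v. a (the_inv_into {..<card E} z v)"
    have *: "?u (z j) = a j" if "j < card E" for j
      using z that by (simp add: bij_betw_def the_inv_into_f_f)
    have eq: "(\<Sum>v\<in>E. scale (?u v) v) = (\<Sum>j<card E. scale (a j) (z j))"
      using sum.reindex_bij_betw[OF z, of "\<lambda>v. scale (?u v) v"] * by simp
    have "(\<Sum>v\<in>E. scale (?u v) v) \<in> span E"
      by (intro span_sum span_scale span_base)
    then have "(\<Sum>v\<in>E. scale (?u v) v) = 0" using a E(4) eq by auto
    moreover have "z j \<in> E" using z j by (auto simp: bij_betw_def)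
    ultimately have "?u (z j) = 0"
      using independentD[OF E(1,2) subset_refl, of ?u] by blast
    then show "a j = 0" using * j by simp
  qed
  moreover have "dim Z - dim (Z \<inter> B) = card E" using E(5) by simp
  ultimately show "dim Z - dim (Z \<inter> B) \<in> {n. ?P n}" by (simp only: mem_Collect_eq)
qed

end

text \<open>The dimension inequality is applied to \<open>Z2 \<inter> B1\<close> and
  \<open>Z1 \<inter> B2\<close> inside \<open>Z2 \<inter> B2\<close>; these two meet in
  \<open>Z1 \<inter> B1\<close>. This is what makes interval multiplicities nonnegative.\<close>

lemma (in vector_space) dim_second_difference_nonneg:
  assumes Z: "subspace Z1" "subspace Z2" "Z1 \<subseteq> Z2" "Z2 \<subseteq> span T" "finite T"
    and B: "subspace B1" "subspace B2" "B1 \<subseteq> B2"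
  shows "dim (Z2 \<inter> B1) + dim (Z1 \<inter> B2) \<le> dim (Z2 \<inter> B2) + dim (Z1 \<inter> B1)"
proof -
  have "dim (Z2 \<inter> B1) + dim (Z1 \<inter> B2) \<le> dim (Z2 \<inter> B2) + dim ((Z2 \<inter> B1) \<inter> (Z1 \<inter> B2))"
  proof (rule dim_add_dim_le)
    show "Z2 \<inter> B2 \<subseteq> span T" using Z by blast
  qed (use Z B in \<open>auto intro: subspace_inter\<close>)
  moreover have "(Z2 \<inter> B1) \<inter> (Z1 \<inter> B2) = Z1 \<inter> B1" using Z B by blast
  ultimately show ?thesis by simp
qed


section \<open>Ranks of persistent homology\<close>

text \<open>All chain groups live in one ambient space of functions with pointwise operations, so
  cycles and boundaries of different complexes can be intersected directly.\<close>

interpretation fun_space: vector_space "\<lambda>(a::'k::field) (c::'b \<Rightarrow> 'k) x. a * c x"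
  by unfold_locales (auto simp: fun_eq_iff algebra_simps)

lemma sum_fun_apply: "(\<Sum>j\<in>A. (f j :: 'b \<Rightarrow> 'k::comm_monoid_add)) x = (\<Sum>j\<in>A. f j x)"
  by (induction A rule: infinite_finite_induct) auto

lemma sum_scale_apply:
  "(\<Sum>j\<in>A. (\<lambda>x. a j * z j x)) = (\<lambda>x. \<Sum>j\<in>A. a j * (z j x :: 'k::field))"
  by (simp add: fun_eq_iff sum_fun_apply)

section \<open>Linear structure of chains, cycles and boundaries\<close>

lemma zero_in_chains: "(0 :: 'a list \<Rightarrow> 'k::field) \<in> chains i K"
  by (simp add: chains_def)

lemma subspace_chains: "fun_space.subspace (chains i K :: ('a list \<Rightarrow> 'k::field) set)"
proof (rule fun_space.subspaceI)
  fix c d :: "'a list \<Rightarrow> 'k" assume "c \<in> chains i K" "d \<in> chains i K"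
  then show "c + d \<in> chains i K"
    unfolding chains_def mem_Collect_eq plus_fun_apply
    by (metis add.right_neutral minus_add_distrib)
next
  fix a and c :: "'a list \<Rightarrow> 'k" assume "c \<in> chains i K"
  then show "(\<lambda>x. a * c x) \<in> chains i K" by (simp add: chains_def)
qed (rule zero_in_chains)

lemma chains_mono: "K \<subseteq> K' \<Longrightarrow> chains i K \<subseteq> chains i K'"
  unfolding chains_def by blast

lemma chains_support:
  assumes "c \<in> chains i K" "K \<subseteq> Pow L" "c vs \<noteq> 0"
  shows "set vs \<subseteq> L" "length vs = Suc i"
  using assms unfolding chains_def by blast+

text \<open>The summation range in \<open>boundary\<close> depends on the chain. Replacing it by the
  fixed finite set \<open>L\<close> makes linearity visible.\<close>

lemma boundary_chain:
  assumes "finite L" "K \<subseteq> Pow L" "c \<in> chains i K"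
  shows "boundary c vs = (if vs = [] then 0 else (\<Sum>v\<in>L. c (v # vs)))"
proof -
  have "{v. c (v # vs) \<noteq> 0} \<subseteq> L" using chains_support(1)[OF assms(3,2)] by force
  then show ?thesis
    using assms(1) by (auto simp: boundary_def intro!: sum.mono_neutral_left)
qed

lemma boundary_add:
  assumes "finite L" "K \<subseteq> Pow L" "c \<in> chains i K" "d \<in> chains i K"
  shows "boundary (c + d) = boundary c + boundary d"
proof -
  have "c + d \<in> chains i K"
    using subspace_chains assms(3,4) by (rule fun_space.subspace_add)
  with assms show ?thesis
    by (simp add: fun_eq_iff boundary_chain[OF assms(1,2)] sum.distrib)
qed

lemma boundary_scale:
  assumes "finite L" "K \<subseteq> Pow L" "c \<in> chains i K"
  shows "boundary (\<lambda>x. a * c x) = (\<lambda>x. a * boundary c x)"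
proof -
  have "(\<lambda>x. a * c x) \<in> chains i K"
    using subspace_chains assms(3) by (rule fun_space.subspace_scale)
  with assms show ?thesis
    by (simp add: fun_eq_iff boundary_chain[OF assms(1,2)] sum_distrib_left)
qed

lemma boundary_zero: "boundary 0 = 0"
  by (simp add: boundary_def fun_eq_iff)

lemma cycles_eq: "cycles i K = {c \<in> chains i K. boundary c = 0}"
  by (simp add: cycles_def zero_fun_def)

lemma subspace_cycles:
  assumes "finite L" "K \<subseteq> Pow L"
  shows "fun_space.subspace (cycles i K :: ('a list \<Rightarrow> 'k::field) set)"
proof (rule fun_space.subspaceI)
  fix c d :: "'a list \<Rightarrow> 'k" assume "c \<in> cycles i K" "d \<in> cycles i K"
  then show "c + d \<in> cycles i K"
    using boundary_add[OF assms, of c i d] fun_space.subspace_add[OF subspace_chains, of c i K d]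
    by (simp add: cycles_eq)
next
  fix a and c :: "'a list \<Rightarrow> 'k" assume "c \<in> cycles i K"
  then show "(\<lambda>x. a * c x) \<in> cycles i K"
    using boundary_scale[OF assms, of c i] fun_space.subspace_scale[OF subspace_chains, of c i K]
    by (simp add: cycles_eq fun_eq_iff)
qed (simp add: cycles_eq boundary_zero zero_in_chains)

lemma subspace_boundaries:
  assumes "finite L" "K \<subseteq> Pow L"
  shows "fun_space.subspace (boundaries i K :: ('a list \<Rightarrow> 'k::field) set)"
proof (rule fun_space.subspaceI)
  show "0 \<in> boundaries i K"
    unfolding boundaries_def using zero_in_chains boundary_zero by (metis image_eqI)
next
  fix c d :: "'a list \<Rightarrow> 'k" assume "c \<in> boundaries i K" "d \<in> boundaries i K"
  then obtain c' d' where "c' \<in> chains (Suc i) K" "c = boundary c'"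
      "d' \<in> chains (Suc i) K" "d = boundary d'"
    by (auto simp: boundaries_def)
  then have "c + d = boundary (c' + d')" "c' + d' \<in> chains (Suc i) K"
    using boundary_add[OF assms, of c' "Suc i" d']
      fun_space.subspace_add[OF subspace_chains, of c' "Suc i" K d'] by auto
  then show "c + d \<in> boundaries i K" unfolding boundaries_def by blast
next
  fix a and c :: "'a list \<Rightarrow> 'k" assume "c \<in> boundaries i K"
  then obtain c' where "c' \<in> chains (Suc i) K" "c = boundary c'"
    by (auto simp: boundaries_def)
  then have "(\<lambda>x. a * c x) = boundary (\<lambda>x. a * c' x)" "(\<lambda>x. a * c' x) \<in> chains (Suc i) K"
    using boundary_scale[OF assms, of c' "Suc i"]
      fun_space.subspace_scale[OF subspace_chains, of c' "Suc i" K] by auto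
  then show "(\<lambda>x. a * c x) \<in> boundaries i K" unfolding boundaries_def by blast
qed

lemma cycles_mono: "K \<subseteq> K' \<Longrightarrow> cycles i K \<subseteq> cycles i K'"
  using chains_mono unfolding cycles_def by blast

lemma boundaries_mono: "K \<subseteq> K' \<Longrightarrow> boundaries i K \<subseteq> boundaries i K'"
  using chains_mono unfolding boundaries_def by blast

text \<open>The indicator functions of the lists of length \<open>Suc i\<close> over
  \<open>L\<close> span a space containing every chain. They need not be alternating; only a finite
  spanning set common to all complexes matters.\<close>

lemma cycles_finite_dimensional:
  fixes L :: "'a set"
  assumes "finite L"
  obtains T :: "('a list \<Rightarrow> 'k::field) set" where "finite T"
    "\<And>K. K \<subseteq> Pow L \<Longrightarrow> cycles i K \<subseteq> fun_space.span T"
proof -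
  define N where "N = {vs :: 'a list. set vs \<subseteq> L \<and> length vs = Suc i}"
  define e where "e = (\<lambda>vs ws :: 'a list. if ws = vs then 1 else (0::'k))"
  have N: "finite N" using finite_lists_length_eq[OF assms] by (simp add: N_def)
  have "c \<in> fun_space.span (e ` N)" if "c \<in> cycles i K" "K \<subseteq> Pow L"
    for c :: "'a list \<Rightarrow> 'k" and K
  proof -
    have "c vs = 0" if "vs \<notin> N" for vs
      using chains_support[of c i K L vs] that \<open>c \<in> cycles i K\<close> \<open>K \<subseteq> Pow L\<close>
      by (auto simp: N_def cycles_def)
    then have "c = (\<Sum>vs\<in>N. (\<lambda>ws. c vs * e vs ws))"
      unfolding sum_scale_apply using N by (auto simp: e_def fun_eq_iff if_distrib cong: if_cong)
    also have "\<dots> \<in> fun_space.span (e ` N)"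
      by (intro fun_space.span_sum fun_space.span_scale fun_space.span_base imageI)
    finally show ?thesis .
  qed
  with N show ?thesis by (intro that[of "e ` N"]) auto
qed

text \<open>If the cosets agree, the zero cycle lies in the coset of \<open>w\<close>, so
  \<open>-w\<close> is a boundary. Conversely, subtracting a boundary does not affect being a
  boundary.\<close>

lemma homology_class_eq_zero_iff:
  fixes w :: "'a list \<Rightarrow> 'k::field"
  assumes "finite L" "K \<subseteq> Pow L"
  shows "homology_class i K w = homology_class i K (\<lambda>vs. 0) \<longleftrightarrow> w \<in> boundaries i K"
proof
  note B = subspace_boundaries[OF assms, of i]
  assume eq: "homology_class i K w = homology_class i K (\<lambda>vs. 0)"
  have "(0 :: 'a list \<Rightarrow> 'k) \<in> homology_class i K (\<lambda>vs. 0)"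
    using fun_space.subspace_0[OF B] fun_space.subspace_0[OF subspace_cycles[OF assms, of i]]
    by (simp add: homology_class_def zero_fun_def)
  then have "(\<lambda>vs. 0 - w vs) \<in> boundaries i K"
    unfolding eq[symmetric] by (simp add: homology_class_def)
  then have "- w \<in> boundaries i K"
    by (simp add: fun_Compl_def)
  then show "w \<in> boundaries i K"
    using fun_space.subspace_neg[OF B, of "- w"] by simp
next
  note B = subspace_boundaries[OF assms, of i]
  assume w: "w \<in> boundaries i K"
  have "(\<lambda>vs. u vs - w vs) \<in> boundaries i K \<longleftrightarrow> u \<in> boundaries i K" for u
  proof -
    have "(\<lambda>vs. u vs - w vs) = u - w" by (simp add: fun_eq_iff)
    then show ?thesis
      using fun_space.subspace_diff[OF B, of u w] fun_space.subspace_add[OF B, of "u - w" w] w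
      by auto
  qed
  then show "homology_class i K w = homology_class i K (\<lambda>vs. 0)"
    by (simp add: homology_class_def)
qed

text \<open>The kernel of the map from cycles of \<open>K\<close> to classes in \<open>K'\<close> is
  \<open>cycles i K \<inter> boundaries i K'\<close>. The identity is stated over the integers
  because differences of ranks are taken later.\<close>

lemma persistent_betti_eq:
  assumes "finite L" "K \<subseteq> Pow L" "K' \<subseteq> Pow L"
  shows "int (persistent_betti TYPE('k::field) i K K') =
    int (fun_space.dim (cycles i K :: ('a list \<Rightarrow> 'k) set))
      - int (fun_space.dim (cycles i K \<inter> boundaries i K' :: ('a list \<Rightarrow> 'k) set))"
proof -
  let ?Z = "cycles i K :: ('a list \<Rightarrow> 'k) set" and ?B = "boundaries i K' :: ('a list \<Rightarrow> 'k) set"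
  obtain T :: "('a list \<Rightarrow> 'k) set" where T: "finite T"
      "\<And>K. K \<subseteq> Pow L \<Longrightarrow> cycles i K \<subseteq> fun_space.span T"
    using cycles_finite_dimensional[OF assms(1)] by metis
  note Z = subspace_cycles[OF assms(1,2)] T(2)[OF assms(2)] T(1) subspace_boundaries[OF assms(1,3)]
  show ?thesis
    unfolding persistent_betti_def homology_class_eq_zero_iff[OF assms(1,3)]
    using fun_space.Max_independent_modulo[OF Z, of i] fun_space.dim_Int_le[OF Z, of i]
    by (simp only: sum_scale_apply of_nat_diff)
qed

text \<open>
  \<open>\<mu> j k\<close> counts the intervals born at step \<open>j\<close> and dying at step \<open>k\<close>; the death index
  \<open>Suc m\<close> encodes the intervals that never die.
\<close>

lemma persistent_betti_interval_decomposition: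
  fixes K :: "nat \<Rightarrow> 'a set set"
  assumes L: "finite L" and K: "\<And>j. K j \<subseteq> Pow L" and mono: "mono K" and K0: "K 0 = {}"
  obtains \<mu> :: "nat \<Rightarrow> nat \<Rightarrow> nat" where
    "\<And>j k. k \<le> m \<Longrightarrow> int (persistent_betti TYPE('k::field) i (K j) (K k)) =
       (\<Sum>j'\<in>{1..j}. \<Sum>k'\<in>{Suc k..Suc m}. int (\<mu> j' k'))"
proof -
  define Z where "Z j = (cycles i (K j) :: ('a list \<Rightarrow> 'k) set)" for j
  \<comment> \<open>Taking the whole space beyond step \<open>m\<close> kills every class at
    \<open>Suc m\<close>, so immortal intervals get a finite death index.\<close>
  define B where "B k = (if k \<le> m then boundaries i (K k) else UNIV :: ('a list \<Rightarrow> 'k) set)" for k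
  define b where "b j k = int (fun_space.dim (Z j)) - int (fun_space.dim (Z j \<inter> B k))" for j k
  \<comment> \<open>The second difference of the ranks. Truncation by \<open>nat\<close> is harmless
    since the second difference is nonnegative.\<close>
  define \<mu> where "\<mu> j k = nat (b j (k - 1) - b (j - 1) (k - 1) - b j k + b (j - 1) k)" for j k
  obtain T :: "('a list \<Rightarrow> 'k) set" where T: "finite T"
      "\<And>K. K \<subseteq> Pow L \<Longrightarrow> cycles i K \<subseteq> fun_space.span T"
    using cycles_finite_dimensional[OF L] by metis
  have Z: "fun_space.subspace (Z j)" "Z j \<subseteq> fun_space.span T" for j
    using subspace_cycles[OF L K] T(2)[OF K] by (auto simp: Z_def)
  have B: "fun_space.subspace (B k)" for k
    using subspace_boundaries[OF L K] by (auto simp: B_def)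
  have Zm: "Z (j - 1) \<subseteq> Z j" for j
    unfolding Z_def by (intro cycles_mono monoD[OF mono]) simp
  have Bm: "B (k - 1) \<subseteq> B k" for k
    using boundaries_mono[OF monoD[OF mono, of "k - 1" k], of i] by (auto simp: B_def)
  have \<mu>: "int (\<mu> j k) = (b j (k - 1) - b j k) - (b (j - 1) (k - 1) - b (j - 1) k)" for j k
  proof -
    have "0 \<le> b j (k - 1) - b (j - 1) (k - 1) - b j k + b (j - 1) k"
      using fun_space.dim_second_difference_nonneg[OF Z(1,1) Zm Z(2) T(1) B B Bm, of j k]
      by (simp add: b_def)
    then show ?thesis by (simp add: \<mu>_def)
  qed
  have b0: "b 0 k = 0" for k
  proof -
    have "Z 0 = {0}"
      using fun_space.subspace_0[OF Z(1), of 0]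
      by (auto simp: Z_def K0 cycles_def chains_def fun_eq_iff)
    moreover have "{0} \<inter> B k = {0}" using fun_space.subspace_0[OF B] by blast
    ultimately show ?thesis by (simp add: b_def)
  qed
  have bm: "b j (Suc m) = 0" for j by (simp add: b_def B_def)
  show ?thesis
  proof (rule that)
    fix j k assume k: "k \<le> m"
    have row: "(\<Sum>k'\<in>{Suc k..Suc m}. b j' (k' - 1) - b j' k') = b j' k" for j'
      \<comment> \<open>Summing over deaths telescopes to the vanishing rank at
        \<open>Suc m\<close>; summing over births below telescopes to the vanishing rank at step
        0.\<close>
      using sum_telescope''[of k "Suc m" "\<lambda>k'. - b j' k'"] k bm by simp
    have rows: "(\<Sum>k'\<in>{Suc k..Suc m}. int (\<mu> j' k')) = b j' k - b (j' - 1) k" for j'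
      unfolding \<mu> row[symmetric] by (rule sum_subtractf)
    have "(\<Sum>j'\<in>{1..j}. \<Sum>k'\<in>{Suc k..Suc m}. int (\<mu> j' k')) = (\<Sum>j'\<in>{Suc 0..j}. b j' k - b (j' - 1) k)"
      by (simp only: rows One_nat_def)
    also have "\<dots> = b j k"
      using sum_telescope''[of 0 j "\<lambda>j'. b j' k"] b0 by simp
    also have "\<dots> = int (persistent_betti TYPE('k) i (K j) (K k))"
      using persistent_betti_eq[OF L K K, where 'k = 'k] k by (simp add: b_def Z_def B_def)
    finally show "int (persistent_betti TYPE('k) i (K j) (K k)) =
       (\<Sum>j'\<in>{1..j}. \<Sum>k'\<in>{Suc k..Suc m}. int (\<mu> j' k'))" by simp
  qed
qed


section \<open>Diagrams and matchings\<close>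

lemma eventually_at_right_le_add_iff:
  "\<forall>\<^sub>F \<epsilon> in at_right 0. c \<le> b + \<epsilon> \<longleftrightarrow> c \<le> (b::real)"
proof (cases "c \<le> b")
  case True
  show ?thesis
    using eventually_at_right_less[of "0::real"] by eventually_elim (use True in auto)
next
  case False
  then have "\<forall>\<^sub>F \<epsilon> in at_right 0. \<epsilon> \<in> {0<..<c - b}" by (intro eventually_at_right_real) simp
  then show ?thesis by eventually_elim (use False in auto)
qed

lemma eventually_at_right_le_diff_iff:
  "\<forall>\<^sub>F \<epsilon> in at_right 0. c \<le> b - \<epsilon> \<longleftrightarrow> c < (b::real)"
proof (cases "c < b")
  case True
  then have "\<forall>\<^sub>F \<epsilon> in at_right 0. \<epsilon> \<in> {0<..<b - c}" by (intro eventually_at_right_real) simp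
  then show ?thesis by eventually_elim (use True in auto)
next
  case False
  show ?thesis
    using eventually_at_right_less[of "0::real"] by eventually_elim (use False in auto)
qed

lemma eventually_at_right_diff_less_iff:
  "\<forall>\<^sub>F \<epsilon> in at_right 0. ereal (d - \<epsilon>) < c \<longleftrightarrow> ereal d \<le> c"
proof (cases c)
  case (real c')
  show ?thesis
    using eventually_at_right_le_diff_iff[of c' d] by eventually_elim (auto simp: real)
qed auto

lemma eventually_at_right_add_less_iff:
  "\<forall>\<^sub>F \<epsilon> in at_right 0. ereal (d + \<epsilon>) < c \<longleftrightarrow> ereal d < c"
proof (cases c)
  case (real c')
  show ?thesis
    using eventually_at_right_le_add_iff[of c' d] by eventually_elim (auto simp: real)
qed auto

lemma eventually_at_top_ereal_less_iff: "\<forall>\<^sub>F s in at_top. ereal s < c \<longleftrightarrow> c = \<infinity>"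
proof (cases c)
  case (real c')
  show ?thesis
    using eventually_ge_at_top[of c'] by eventually_elim (auto simp: real)
qed auto

text \<open>The equivalence holds for all \<open>n\<close> on a common set of the filter;
  nontriviality of the filter then gives uniqueness.\<close>

lemma the_eventually_eq:
  assumes "F \<noteq> bot" "\<forall>\<^sub>F x in F. \<forall>n. P n x \<longleftrightarrow> n = N"
  shows "(THE n. \<forall>\<^sub>F x in F. P n x) = N"
proof (rule the_equality)
  show "\<forall>\<^sub>F x in F. P N x" using assms(2) by eventually_elim simp
  fix n assume "\<forall>\<^sub>F x in F. P n x"
  with assms(2) have "\<forall>\<^sub>F x in F. n = N" by eventually_elim simp
  then show "n = N" using assms(1) by simp
qed

text \<open>The pushforward of the weights \<open>\<mu>\<close> along \<open>P\<close>, cut off to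
  points strictly above the diagonal because \<open>dgm\<close> vanishes elsewhere.\<close>

definition weighted_diagram ::
    "'b set \<Rightarrow> ('b \<Rightarrow> nat) \<Rightarrow> ('b \<Rightarrow> real \<times> ereal) \<Rightarrow> real \<times> ereal \<Rightarrow> nat" where
  "weighted_diagram I \<mu> P p =
     (if ereal (fst p) < snd p then \<Sum>x\<in>{x\<in>I. P x = p}. \<mu> x else 0)"

text \<open>For small \<open>\<epsilon>\<close>, the alternating sum gives \<open>x\<close> the
  weight \<open>\<mu> x\<close> times ([birth <= b] - [birth < b]) times ([d <= death] -
  [d < death]), which is the indicator of \<open>P x = (b, d)\<close>. For infinite \<open>d\<close>
  the second factor becomes [death = infinity]. Finiteness of \<open>I\<close> provides one
  \<open>\<epsilon>\<close> for all \<open>x\<close>.\<close>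

lemma dgm_eq_weighted_diagram:
  fixes P :: "'b \<Rightarrow> real \<times> ereal" and \<mu> :: "'b \<Rightarrow> nat"
  assumes I: "finite I"
    and \<beta>: "\<And>r s. int (persistent_betti k i (F r) (F s)) =
      (\<Sum>x\<in>{x\<in>I. fst (P x) \<le> r \<and> ereal s < snd (P x)}. int (\<mu> x))"
  shows "dgm k i F = weighted_diagram I \<mu> P"
proof
  fix p :: "real \<times> ereal"
  obtain b d where p: "p = (b, d)" by fastforce
  define N where "N = (\<Sum>x\<in>{x\<in>I. P x = p}. \<mu> x)"
  have N: "int N = (\<Sum>x\<in>I. of_bool (fst (P x) = b) * of_bool (snd (P x) = d) * int (\<mu> x))"
    unfolding N_def of_nat_sum sum.inter_filter[OF I]
    by (intro sum.cong) (auto simp: p prod_eq_iff)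
  have \<beta>': "int (persistent_betti k i (F r) (F s)) =
      (\<Sum>x\<in>I. of_bool (fst (P x) \<le> r) * of_bool (ereal s < snd (P x)) * int (\<mu> x))" for r s
    unfolding \<beta> sum.inter_filter[OF I] by (intro sum.cong) auto
  show "dgm k i F p = weighted_diagram I \<mu> P p"
  proof (cases "ereal b < d")
    case False
    then show ?thesis by (simp add: p dgm_def weighted_diagram_def)
  next
    case lt: True
    then have R: "weighted_diagram I \<mu> P p = N" by (simp add: weighted_diagram_def N_def p)
    have up: "\<forall>\<^sub>F \<epsilon> in at_right 0. \<forall>x\<in>I. fst (P x) \<le> b + \<epsilon> \<longleftrightarrow> fst (P x) \<le> b"
      using I by (intro eventually_ball_finite ballI eventually_at_right_le_add_iff)
    have down: "\<forall>\<^sub>F \<epsilon> in at_right 0. \<forall>x\<in>I. fst (P x) \<le> b - \<epsilon> \<longleftrightarrow> fst (P x) < b"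
      using I by (intro eventually_ball_finite ballI eventually_at_right_le_diff_iff)
    show ?thesis
    proof (cases "d = \<infinity>")
      case True
      have top: "\<forall>\<^sub>F s in at_top. \<forall>x\<in>I. ereal s < snd (P x) \<longleftrightarrow> snd (P x) = \<infinity>"
        using I by (intro eventually_ball_finite ballI eventually_at_top_ereal_less_iff)
      have eq: "(\<forall>\<^sub>F s in at_top. int n = int (persistent_betti k i (F (b + \<epsilon>)) (F s))
          - int (persistent_betti k i (F (b - \<epsilon>)) (F s))) \<longleftrightarrow> n = N"
        if up: "\<forall>x\<in>I. fst (P x) \<le> b + \<epsilon> \<longleftrightarrow> fst (P x) \<le> b"
          and down: "\<forall>x\<in>I. fst (P x) \<le> b - \<epsilon> \<longleftrightarrow> fst (P x) < b" for \<epsilon> n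
      proof -
        have "\<forall>\<^sub>F s in at_top. int (persistent_betti k i (F (b + \<epsilon>)) (F s))
          - int (persistent_betti k i (F (b - \<epsilon>)) (F s)) = int N"
          using top
        proof eventually_elim
          case (elim s)
          show ?case
            unfolding \<beta>' N sum_subtractf[symmetric]
            using elim up down by (intro sum.cong refl) (auto simp: True)
        qed
        then have "(\<forall>\<^sub>F s in at_top. int n = int (persistent_betti k i (F (b + \<epsilon>)) (F s))
          - int (persistent_betti k i (F (b - \<epsilon>)) (F s))) \<longleftrightarrow> (\<forall>\<^sub>F s::real in at_top. n = N)"
          by (intro eventually_subst) (auto elim!: eventually_mono)
        then show ?thesis by simp
      qed
      have "\<forall>\<^sub>F \<epsilon> in at_right 0. \<forall>n. (\<forall>\<^sub>F s in at_top.
          int n = int (persistent_betti k i (F (b + \<epsilon>)) (F s))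
            - int (persistent_betti k i (F (b - \<epsilon>)) (F s))) \<longleftrightarrow> n = N"
        using up down by eventually_elim (simp add: eq)
      from the_eventually_eq[OF _ this] show ?thesis
        unfolding R using lt by (simp add: p dgm_def True)
    next
      case False
      with lt obtain d' where d: "d = ereal d'" by (cases d) auto
      have dn: "\<forall>\<^sub>F \<epsilon> in at_right 0. \<forall>x\<in>I. ereal (d' - \<epsilon>) < snd (P x) \<longleftrightarrow> d \<le> snd (P x)"
        unfolding d using I by (intro eventually_ball_finite ballI eventually_at_right_diff_less_iff)
      have du: "\<forall>\<^sub>F \<epsilon> in at_right 0. \<forall>x\<in>I. ereal (d' + \<epsilon>) < snd (P x) \<longleftrightarrow> d < snd (P x)"
        unfolding d using I by (intro eventually_ball_finite ballI eventually_at_right_add_less_iff)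
      have "\<forall>\<^sub>F \<epsilon> in at_right 0. \<forall>n. int n =
          int (persistent_betti k i (F (b + \<epsilon>)) (F (d' - \<epsilon>)))
          - int (persistent_betti k i (F (b - \<epsilon>)) (F (d' - \<epsilon>)))
          - int (persistent_betti k i (F (b + \<epsilon>)) (F (d' + \<epsilon>)))
          + int (persistent_betti k i (F (b - \<epsilon>)) (F (d' + \<epsilon>))) \<longleftrightarrow> n = N"
        using up down dn du
      proof eventually_elim
        case (elim \<epsilon>)
        have "int (persistent_betti k i (F (b + \<epsilon>)) (F (d' - \<epsilon>)))
          - int (persistent_betti k i (F (b - \<epsilon>)) (F (d' - \<epsilon>)))
          - int (persistent_betti k i (F (b + \<epsilon>)) (F (d' + \<epsilon>)))
          + int (persistent_betti k i (F (b - \<epsilon>)) (F (d' + \<epsilon>))) = int N"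
          unfolding \<beta>' N sum_subtractf[symmetric] sum.distrib[symmetric]
          using elim by (intro sum.cong refl) auto
        then show ?case by auto
      qed
      from the_eventually_eq[OF _ this] show ?thesis
        unfolding R using lt by (simp add: p dgm_def d)
    qed
  qed
qed

text \<open>A bottleneck bound witnessed by an actual bijection. Such witnesses compose, with costs
  adding, whereas the infimum in \<open>bottleneck\<close> need not come with one.\<close>

definition matched_within ::
    "real \<Rightarrow> (real \<times> ereal \<Rightarrow> nat) \<Rightarrow> (real \<times> ereal \<Rightarrow> nat) \<Rightarrow> bool" where
  "matched_within e m m' \<longleftrightarrow> (\<exists>\<eta>. bij_betw \<eta> (dgm_points m) (dgm_points m') \<and>
     (\<forall>p\<in>dgm_points m. linf_dist (fst p) (fst (\<eta> p)) \<le> ereal e))"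

lemma bottleneck_le_matched_within:
  assumes "matched_within e m m'"
  shows "bottleneck m m' \<le> ereal e"
proof -
  obtain \<eta> where "bij_betw \<eta> (dgm_points m) (dgm_points m')"
      "\<forall>p\<in>dgm_points m. linf_dist (fst p) (fst (\<eta> p)) \<le> ereal e"
    using assms by (auto simp: matched_within_def)
  then show ?thesis
    unfolding bottleneck_def by (intro INF_lower2[of \<eta>] SUP_least) auto
qed

section \<open>Composition of matchings\<close>

lemma ereal_dist_nonneg: "0 \<le> ereal_dist x y"
  by (simp add: ereal_dist_def)

lemma ereal_dist_triangle:
  assumes "ereal_dist x y \<le> ereal a" "ereal_dist y z \<le> ereal b"
  shows "ereal_dist x z \<le> ereal (a + b)"
proof -
  \<comment> \<open>Nonnegativity of both bounds settles the cases with coinciding points;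
    finiteness of the bounds forces an infinite value to be paired only with itself.\<close>
  have "ereal 0 \<le> ereal a" "ereal 0 \<le> ereal b"
    using assms ereal_dist_nonneg order_trans unfolding zero_ereal_def[symmetric] by blast+
  with assms show ?thesis
    by (cases x; cases y; cases z) (auto simp: ereal_dist_def split: if_splits)
qed

lemma linf_dist_triangle:
  assumes "linf_dist p q \<le> ereal a" "linf_dist q r \<le> ereal b"
  shows "linf_dist p r \<le> ereal (a + b)"
  using assms ereal_dist_triangle[of "snd p" "snd q" a "snd r" b]
  by (auto simp: linf_dist_def)

lemma matched_within_trans:
  assumes "matched_within a m1 m2" "matched_within b m2 m3"
  shows "matched_within (a + b) m1 m3"
proof -
  obtain \<eta> where \<eta>: "bij_betw \<eta> (dgm_points m1) (dgm_points m2)"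
      "\<And>p. p \<in> dgm_points m1 \<Longrightarrow> linf_dist (fst p) (fst (\<eta> p)) \<le> ereal a"
    using assms(1) by (auto simp: matched_within_def)
  obtain \<theta> where \<theta>: "bij_betw \<theta> (dgm_points m2) (dgm_points m3)"
      "\<And>p. p \<in> dgm_points m2 \<Longrightarrow> linf_dist (fst p) (fst (\<theta> p)) \<le> ereal b"
    using assms(2) by (auto simp: matched_within_def)
  show ?thesis
    unfolding matched_within_def
  proof (intro exI[of _ "\<theta> \<circ> \<eta>"] conjI ballI)
    show "bij_betw (\<theta> \<circ> \<eta>) (dgm_points m1) (dgm_points m3)"
      using \<eta>(1) \<theta>(1) by (rule bij_betw_trans)
    fix p assume p: "p \<in> dgm_points m1"
    with \<eta>(1) have "\<eta> p \<in> dgm_points m2" by (rule bij_betw_apply)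
    then show "linf_dist (fst p) (fst ((\<theta> \<circ> \<eta>) p)) \<le> ereal (a + b)"
      using linf_dist_triangle[OF \<eta>(2)[OF p] \<theta>(2)] by simp
  qed
qed

text \<open>The bijections between fibres are glued. Since the result preserves labels, points of
  different fibres cannot collide.\<close>

lemma bij_betw_fibrewise:
  assumes "\<And>p. \<exists>h. bij_betw h {y\<in>M. l y = p} {z\<in>N. l' z = p}"
  obtains A where "bij_betw A M N" "\<forall>y\<in>M. l' (A y) = l y"
proof -
  obtain h where h: "\<And>p. bij_betw (h p) {y\<in>M. l y = p} {z\<in>N. l' z = p}"
    using assms by metis
  define A where "A y = h (l y) y" for y
  have A: "A y \<in> N \<and> l' (A y) = l y" if "y \<in> M" for y
    using bij_betw_apply[OF h[of "l y"], of y] that by (simp add: A_def)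
  have "inj_on A M"
  proof (rule inj_onI)
    fix x y assume xy: "x \<in> M" "y \<in> M" "A x = A y"
    then have "l x = l y" using A by metis
    with xy show "x = y"
      using inj_onD[OF bij_betw_imp_inj_on[OF h[of "l x"]], of x y] by (simp add: A_def)
  qed
  moreover have "z \<in> A ` M" if "z \<in> N" for z
  proof -
    have "z \<in> h (l' z) ` {y\<in>M. l y = l' z}"
      using bij_betw_imp_surj_on[OF h[of "l' z"]] that by simp
    then obtain y where "y \<in> M" "l y = l' z" "z = h (l' z) y" by auto
    then have "z = A y" by (simp add: A_def)
    with \<open>y \<in> M\<close> show ?thesis by blast
  qed
  ultimately show ?thesis using A by (intro that[of A]) (auto simp: bij_betw_def)
qed

text \<open>
  Points of \<open>I\<close> lying on the diagonal are absorbed by the infinite multiplicity of the diagonal.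
\<close>

lemma dgm_points_weighted_diagram:
  assumes I: "finite I" and P: "\<And>x. x \<in> I \<Longrightarrow> ereal (fst (P x)) \<le> snd (P x)"
  obtains A where
    "bij_betw A ((SIGMA x:I. {..<\<mu> x}) <+> (UNIV :: (real \<times> nat) set))
       (dgm_points (weighted_diagram I \<mu> P))"
    "\<forall>x\<in>I. \<forall>n<\<mu> x. fst (A (Inl (x, n))) = P x"
    "\<forall>b n. fst (A (Inr (b, n))) = (b, ereal b)"
proof -
  let ?M = "(SIGMA x:I. {..<\<mu> x}) <+> (UNIV :: (real \<times> nat) set)"
  let ?N = "dgm_points (weighted_diagram I \<mu> P)"
  \<comment> \<open>The label of a copy is its position in the plane; the two sides are compared
    fibre by fibre over positions.\<close>
  define l where "l = case_sum (\<lambda>(x, n :: nat). P x) (\<lambda>(b, n :: nat). (b, ereal b))"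
  have "\<exists>h. bij_betw h {y\<in>?M. l y = p} {z\<in>?N. fst z = p}" for p
  proof (cases "snd p = ereal (fst p)")
    \<comment> \<open>Over a diagonal point both fibres are countably infinite, however many copies
      from \<open>I\<close> land there.\<close>
    case True
    then obtain b where p: "p = (b, ereal b)" by (metis prod.collapse)
    have "{y\<in>?M. l y = p} \<subseteq> Inl ` (SIGMA x:I. {..<\<mu> x}) \<union> range (\<lambda>n :: nat. Inr (b, n))"
      by (auto simp: l_def p)
    moreover have "countable (Inl ` (SIGMA x:I. {..<\<mu> x}) \<union> range (\<lambda>n :: nat. Inr (b, n)))"
      using I by (intro countable_Un countable_image) (auto intro: countable_finite)
    ultimately have "countable {y\<in>?M. l y = p}" by (rule countable_subset)
    moreover have "infinite {y\<in>?M. l y = p}"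
    proof
      assume "finite {y\<in>?M. l y = p}"
      then have "finite (range (\<lambda>n :: nat. Inr (b, n) :: ('a \<times> nat) + real \<times> nat))"
        by (rule rev_finite_subset) (auto simp: l_def p)
      then show False using range_inj_infinite[of "\<lambda>n :: nat. Inr (b, n) :: ('a \<times> nat) + real \<times> nat"]
        by (auto simp: inj_on_def)
    qed
    ultimately obtain u where u: "bij_betw u {y\<in>?M. l y = p} (UNIV :: nat set)"
      by (rule countableE_infinite)
    have "{z\<in>?N. fst z = p} = range (\<lambda>n. (p, n))"
      by (auto simp: dgm_points_def p)
    then have "bij_betw (\<lambda>n. (p, n)) (UNIV :: nat set) {z\<in>?N. fst z = p}"
      by (auto simp: bij_betw_def inj_on_def)
    then show ?thesis using bij_betw_trans[OF u] by blast
  next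
    \<comment> \<open>Off the diagonal both fibres are finite. Their sizes agree above the diagonal
      by definition of \<open>weighted_diagram\<close>, and below it both are empty by the
      assumption on \<open>P\<close>.\<close>
    case False
    have M: "{y\<in>?M. l y = p} = Inl ` (SIGMA x:{x\<in>I. P x = p}. {..<\<mu> x})"
      using False by (auto simp: l_def)
    have N: "{z\<in>?N. fst z = p} = Pair p ` {..<weighted_diagram I \<mu> P p}"
      using False by (auto simp: dgm_points_def)
    have "card {y\<in>?M. l y = p} = (\<Sum>x\<in>{x\<in>I. P x = p}. \<mu> x)"
      unfolding M using I by (simp add: card_image)
    also have "\<dots> = weighted_diagram I \<mu> P p"
    proof (cases "ereal (fst p) < snd p")
      case False
      then have "{x\<in>I. P x = p} = {}" using P \<open>snd p \<noteq> _\<close> by force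
      then show ?thesis using False by (simp only: weighted_diagram_def) simp
    qed (simp add: weighted_diagram_def)
    also have "\<dots> = card {z\<in>?N. fst z = p}"
      unfolding N by (simp add: card_image inj_on_def)
    finally have "card {y\<in>?M. l y = p} = card {z\<in>?N. fst z = p}" .
    moreover have "finite {y\<in>?M. l y = p}" "finite {z\<in>?N. fst z = p}"
      unfolding M N using I by auto
    ultimately show ?thesis by (intro finite_same_card_bij)
  qed
  then obtain A where A: "bij_betw A ?M ?N" "\<forall>y\<in>?M. fst (A y) = l y"
    by (rule bij_betw_fibrewise)
  show ?thesis
    using A(1)
  proof (rule that)
    have "fst (A (Inl (x, n))) = P x" if "x \<in> I" "n < \<mu> x" for x n
      using bspec[OF A(2), of "Inl (x, n)"] that by (auto simp: l_def)
    then show "\<forall>x\<in>I. \<forall>n<\<mu> x. fst (A (Inl (x, n))) = P x" by blast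
    have "fst (A (Inr (b, n))) = (b, ereal b)" for b n
      using bspec[OF A(2), of "Inr (b, n)"] by (auto simp: l_def)
    then show "\<forall>b n. fst (A (Inr (b, n))) = (b, ereal b)" by blast
  qed
qed

text \<open>Both diagrams are parametrised by the same set of copies, determined by \<open>I\<close>
  and \<open>\<mu>\<close>. Following one parametrisation back and the other forward moves a copy of
  \<open>x\<close> from \<open>P x\<close> to \<open>Q x\<close> and keeps the added diagonal
  positions fixed.\<close>

lemma matched_within_weighted_diagram:
  assumes I: "finite I" and e: "0 \<le> e"
    and P: "\<And>x. x \<in> I \<Longrightarrow> ereal (fst (P x)) \<le> snd (P x)"
    and Q: "\<And>x. x \<in> I \<Longrightarrow> ereal (fst (Q x)) \<le> snd (Q x)"
    and PQ: "\<And>x. x \<in> I \<Longrightarrow> linf_dist (P x) (Q x) \<le> ereal e"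
  shows "matched_within e (weighted_diagram I \<mu> P) (weighted_diagram I \<mu> Q)"
proof -
  let ?M = "(SIGMA x:I. {..<\<mu> x}) <+> (UNIV :: (real \<times> nat) set)"
  obtain A where A: "bij_betw A ?M (dgm_points (weighted_diagram I \<mu> P))"
    "\<forall>x\<in>I. \<forall>n<\<mu> x. fst (A (Inl (x, n))) = P x"
    "\<forall>b n. fst (A (Inr (b, n))) = (b, ereal b)"
    by (rule dgm_points_weighted_diagram[where I = I and \<mu> = \<mu> and P = P, OF I P])
  obtain B where B: "bij_betw B ?M (dgm_points (weighted_diagram I \<mu> Q))"
    "\<forall>x\<in>I. \<forall>n<\<mu> x. fst (B (Inl (x, n))) = Q x"
    "\<forall>b n. fst (B (Inr (b, n))) = (b, ereal b)"
    by (rule dgm_points_weighted_diagram[where I = I and \<mu> = \<mu> and P = Q, OF I Q])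
  have AB: "linf_dist (fst (A y)) (fst (B y)) \<le> ereal e" if "y \<in> ?M" for y
  proof (cases y)
    case (Inl a)
    with that A(2) B(2) have "fst (A y) = P (fst a)" "fst (B y) = Q (fst a)" "fst a \<in> I" by auto
    then show ?thesis using PQ by simp
  next
    case (Inr a)
    with A(3) B(3) have "fst (A y) = fst (B y)" by (metis surj_pair)
    then show ?thesis using e by (simp add: linf_dist_def ereal_dist_def)
  qed
  show ?thesis
    unfolding matched_within_def
  proof (intro exI[of _ "B \<circ> the_inv_into ?M A"] conjI ballI)
    show "bij_betw (B \<circ> the_inv_into ?M A) (dgm_points (weighted_diagram I \<mu> P))
        (dgm_points (weighted_diagram I \<mu> Q))"
      using bij_betw_the_inv_into[OF A(1)] B(1) by (rule bij_betw_trans)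
    fix p assume p: "p \<in> dgm_points (weighted_diagram I \<mu> P)"
    then have "the_inv_into ?M A p \<in> ?M"
      using bij_betw_apply[OF bij_betw_the_inv_into[OF A(1)]] by blast
    moreover have "A (the_inv_into ?M A p) = p"
      using A(1) p by (simp add: f_the_inv_into_f_bij_betw)
    ultimately show "linf_dist (fst p) (fst ((B \<circ> the_inv_into ?M A) p)) \<le> ereal e"
      using AB[of "the_inv_into ?M A p"] by simp
  qed
qed


section \<open>Stability of sublevel filtrations\<close>

text \<open>Translates a real threshold into a step of a discrete filtration: one \<open>n\<close>
  serves both as prefix length and as cut-off for indices.\<close>

lemma sorted_sublevel_eq_take:
  fixes f :: "'b \<Rightarrow> 'c::linorder"
  assumes "sorted (map f xs)"
  obtains n where "n \<le> length xs" "{x \<in> set xs. f x \<le> r} = set (take n xs)"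
    "\<And>j. j < length xs \<Longrightarrow> f (xs ! j) \<le> r \<longleftrightarrow> j < n"
proof -
  have "\<exists>n \<le> length xs. {x \<in> set xs. f x \<le> r} = set (take n xs) \<and>
      (\<forall>j < length xs. f (xs ! j) \<le> r \<longleftrightarrow> j < n)"
    using assms
  proof (induction xs)
    case (Cons x xs)
    then obtain n where n: "n \<le> length xs" "{x \<in> set xs. f x \<le> r} = set (take n xs)"
        "\<forall>j < length xs. f (xs ! j) \<le> r \<longleftrightarrow> j < n" by auto
    show ?case
    proof (cases "f x \<le> r")
      case True
      with n show ?thesis
        by (intro exI[of _ "Suc n"]) (auto simp: less_Suc_eq_0_disj)
    next
      case False
      have none: "\<not> f y \<le> r" if "y \<in> set (x # xs)" for y
        using that Cons.prems False by auto
      show ?thesis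
      proof (intro exI[of _ 0] conjI allI impI)
        show "{y \<in> set (x # xs). f y \<le> r} = set (take 0 (x # xs))" using none by auto
        show "f ((x # xs) ! j) \<le> r \<longleftrightarrow> j < 0" if "j < length (x # xs)" for j
          using none[OF nth_mem[OF that]] by simp
      qed simp
    qed
  qed simp
  then show ?thesis using that by blast
qed

text \<open>
  If no two simplices are ordered oppositely by \<open>f\<close> and \<open>g\<close>, both filtrations are
  reparametrisations of one filtration (by \<open>f + g\<close>), and both diagrams are images of
  its intervals.
\<close>

lemma matched_within_comonotone:
  fixes f g :: "'a set \<Rightarrow> real"
  assumes L: "finite L" and D: "D \<subseteq> Pow L" and e: "0 \<le> e"
    and fg: "\<And>\<sigma>. \<sigma> \<in> D \<Longrightarrow> \<bar>f \<sigma> - g \<sigma>\<bar> \<le> e"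
    and co: "\<And>\<sigma> \<tau>. \<sigma> \<in> D \<Longrightarrow> \<tau> \<in> D \<Longrightarrow> f \<sigma> < f \<tau> \<Longrightarrow> g \<sigma> \<le> g \<tau>"
  shows "matched_within e (dgm TYPE('k::field) i (\<lambda>r. {\<sigma>\<in>D. f \<sigma> \<le> r}))
           (dgm TYPE('k) i (\<lambda>r. {\<sigma>\<in>D. g \<sigma> \<le> r}))"
proof -
  have "finite D" using L D finite_subset by blast
  then obtain ys where "set ys = D" using finite_list by blast
  \<comment> \<open>Sorting by the sum sorts by \<open>f\<close> and \<open>g\<close> at once: a
    strict descent of one function must be compensated by a strict ascent of the other, which
    comonotonicity forbids.\<close>
  define xs where "xs = sort_key (\<lambda>\<sigma>. f \<sigma> + g \<sigma>) ys"
  define m where "m = length xs"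
  have xs: "set xs = D" using \<open>set ys = D\<close> by (simp add: xs_def)
  have le: "f (xs ! j) \<le> f (xs ! k) \<and> g (xs ! j) \<le> g (xs ! k)" if "j \<le> k" "k < m" for j k
  proof -
    have "sorted (map (\<lambda>\<sigma>. f \<sigma> + g \<sigma>) xs)" by (simp add: xs_def)
    then have "f (xs ! j) + g (xs ! j) \<le> f (xs ! k) + g (xs ! k)"
      using that sorted_nth_mono[of "map (\<lambda>\<sigma>. f \<sigma> + g \<sigma>) xs" j k] by (simp add: m_def)
    moreover have "xs ! j \<in> D" "xs ! k \<in> D" using that xs by (auto simp: m_def)
    ultimately show ?thesis using co[of "xs ! k" "xs ! j"] co[of "xs ! j" "xs ! k"] by argo
  qed
  \<comment> \<open>Ties are broken arbitrarily, so a prefix may fail to be closed under faces; the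
    interval decomposition covers any increasing sequence of families of subsets of \<open>L\<close>
    that starts empty.\<close>
  define K where "K n = set (take n xs)" for n
  have K: "K n \<subseteq> Pow L" "mono K" "K 0 = {}" for n
    using D xs set_take_subset[of n xs] by (auto simp: K_def mono_def set_take_subset_set_take)
  obtain \<mu> :: "nat \<Rightarrow> nat \<Rightarrow> nat" where \<mu>:
    "\<And>j k. k \<le> m \<Longrightarrow> int (persistent_betti TYPE('k::field) i (K j) (K k)) =
       (\<Sum>j'\<in>{1..j}. \<Sum>k'\<in>{Suc k..Suc m}. int (\<mu> j' k'))"
    using persistent_betti_interval_decomposition[OF L K, where 'k = 'k and m = m and i = i] by metis
  define I where "I = {(j, k). j \<in> {1..m} \<and> k \<in> {1..Suc m} \<and> j < k}"
  \<comment> \<open>Step \<open>j\<close> adds the entry with index \<open>j - 1\<close>, hence the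
    shift; the death index \<open>Suc m\<close> stands for infinity.\<close>
  define P where "P h = (\<lambda>(j, k). (h (xs ! (j - 1)), if k \<le> m then ereal (h (xs ! (k - 1))) else \<infinity>))"
    for h :: "'a set \<Rightarrow> real"
  have "finite ({1..m} \<times> {1..Suc m})" by simp
  moreover have "I \<subseteq> {1..m} \<times> {1..Suc m}" by (auto simp: I_def)
  ultimately have I: "finite I" by (rule rev_finite_subset)
  have dgm: "dgm TYPE('k) i (\<lambda>r. {\<sigma>\<in>D. h \<sigma> \<le> r}) = weighted_diagram I (\<lambda>(j, k). \<mu> j k) (P h)"
    if h: "\<And>j k. j \<le> k \<Longrightarrow> k < m \<Longrightarrow> h (xs ! j) \<le> h (xs ! k)" for h
  proof -
    \<comment> \<open>The rank decomposition sums over the full rectangle. Pairs with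
      \<open>k \<le> j\<close> land on or below the diagonal and are discarded afterwards, leaving
      \<open>I\<close>, on which birth never exceeds death.\<close>
    let ?J = "{1..m} \<times> {1..Suc m}"
    have "sorted (map h xs)" using h by (simp add: sorted_iff_nth_mono m_def)
    note sub = sorted_sublevel_eq_take[OF this]
    have "dgm TYPE('k) i (\<lambda>r. {\<sigma>\<in>D. h \<sigma> \<le> r}) = weighted_diagram ?J (\<lambda>(j, k). \<mu> j k) (P h)"
    proof (rule dgm_eq_weighted_diagram)
      fix r s
      obtain n where n: "n \<le> m" "{\<sigma>\<in>D. h \<sigma> \<le> r} = K n"
          "\<And>j. j < m \<Longrightarrow> h (xs ! j) \<le> r \<longleftrightarrow> j < n"
        using sub[of r] unfolding xs K_def m_def by metis
      obtain n' where n': "n' \<le> m" "{\<sigma>\<in>D. h \<sigma> \<le> s} = K n'"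
          "\<And>j. j < m \<Longrightarrow> h (xs ! j) \<le> s \<longleftrightarrow> j < n'"
        using sub[of s] unfolding xs K_def m_def by metis
      have birth: "fst (P h (j, k)) \<le> r \<longleftrightarrow> j \<le> n" if "j \<in> {1..m}" for j k
        using n(3)[of "j - 1"] that by (cases j) (auto simp: P_def Suc_le_eq)
      have death: "ereal s < snd (P h (j, k)) \<longleftrightarrow> n' < k" if "k \<in> {1..Suc m}" for j k
      proof (cases "k \<le> m")
        case True
        then show ?thesis using n'(3)[of "k - 1"] that by (cases k) (auto simp: P_def less_Suc_eq_le)
      next
        case False
        then show ?thesis using n'(1) by (simp add: P_def)
      qed
      have "x \<in> {x\<in>?J. fst (P h x) \<le> r \<and> ereal s < snd (P h x)} \<longleftrightarrow> x \<in> {1..n} \<times> {Suc n'..Suc m}" for x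
      proof (cases x)
        case (Pair j k)
        show ?thesis
          using birth[of j k] death[of k j] n(1) n'(1) unfolding Pair by auto
      qed
      then have J: "{x\<in>?J. fst (P h x) \<le> r \<and> ereal s < snd (P h x)} = {1..n} \<times> {Suc n'..Suc m}"
        by blast
      show "int (persistent_betti TYPE('k) i {\<sigma>\<in>D. h \<sigma> \<le> r} {\<sigma>\<in>D. h \<sigma> \<le> s}) =
          (\<Sum>x\<in>{x\<in>?J. fst (P h x) \<le> r \<and> ereal s < snd (P h x)}. int ((\<lambda>(j, k). \<mu> j k) x))"
        unfolding n(2) n'(2) \<mu>[OF n'(1)] J sum.cartesian_product by (rule sum.cong) auto
    qed simp
    also have "\<dots> = weighted_diagram I (\<lambda>(j, k). \<mu> j k) (P h)"
    proof
      fix p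
      have "j < k" if "j \<in> {1..m}" "k \<in> {1..Suc m}" "ereal (fst (P h (j, k))) < snd (P h (j, k))" for j k
      proof (rule ccontr)
        assume "\<not> j < k"
        then have "k \<le> m" "k - 1 \<le> j - 1" "j - 1 < m" using that by auto
        then show False using h[of "k - 1" "j - 1"] that(3) by (simp add: P_def)
      qed
      then have eq: "{x\<in>?J. P h x = p} = {x\<in>I. P h x = p}" if "ereal (fst p) < snd p"
        using that by (auto simp: I_def)
      show "weighted_diagram ?J (\<lambda>(j, k). \<mu> j k) (P h) p =
          weighted_diagram I (\<lambda>(j, k). \<mu> j k) (P h) p"
      proof (cases "ereal (fst p) < snd p")
        case True
        show ?thesis unfolding weighted_diagram_def eq[OF True] ..
      next
        case False
        then show ?thesis by (simp add: weighted_diagram_def)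
      qed
    qed
    finally show ?thesis .
  qed
  have diag: "ereal (fst (P h x)) \<le> snd (P h x)"
    if h: "\<And>j k. j \<le> k \<Longrightarrow> k < m \<Longrightarrow> h (xs ! j) \<le> h (xs ! k)" and "x \<in> I" for h x
    using that(2) h[of "fst x - 1" "snd x - 1"] by (auto simp: I_def P_def)
  have dist: "linf_dist (P f x) (P g x) \<le> ereal e" if "x \<in> I" for x
  proof -
    obtain j k where x: "x = (j, k)" by fastforce
    have "\<bar>f (xs ! (l - 1)) - g (xs ! (l - 1))\<bar> \<le> e" if "l \<in> {1..m}" for l
      using that fg[of "xs ! (l - 1)"] xs by (auto simp: m_def)
    from this[of j] this[of k] show ?thesis
      using that e by (auto simp: x I_def P_def linf_dist_def ereal_dist_def)
  qed
  show ?thesis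
    using dgm[of f] dgm[of g] diag[of f] diag[of g] le dist
      matched_within_weighted_diagram[OF I e, of "P f" "P g" "\<lambda>(j, k). \<mu> j k"] by simp
qed

text \<open>Stopping at the first crossing keeps the initial piece comonotone and turns an inversion
  into a tie, so the induction on inversions proceeds.\<close>

lemma matched_within_sublevel:
  fixes f g :: "'a set \<Rightarrow> real"
  assumes L: "finite L" and D: "D \<subseteq> Pow L" and e: "0 \<le> e"
    and fg: "\<And>\<sigma>. \<sigma> \<in> D \<Longrightarrow> \<bar>f \<sigma> - g \<sigma>\<bar> \<le> e"
  shows "matched_within e (dgm TYPE('k::field) i (\<lambda>r. {\<sigma>\<in>D. f \<sigma> \<le> r}))
           (dgm TYPE('k) i (\<lambda>r. {\<sigma>\<in>D. g \<sigma> \<le> r}))"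
proof -
  define inv where "inv h = {(\<sigma>, \<tau>) \<in> D \<times> D. h \<sigma> < h \<tau> \<and> g \<tau> < g \<sigma>}" for h :: "'a set \<Rightarrow> real"
  have "finite D" using L D finite_subset by blast
  have fin: "finite (inv h)" for h
    by (rule finite_subset[of _ "D \<times> D"]) (use \<open>finite D\<close> in \<open>auto simp: inv_def\<close>)
  show ?thesis
    using e fg
  proof (induction "card (inv f)" arbitrary: f e rule: less_induct)
    case less
    note e = less.prems(1) and fg = less.prems(2)
    show ?case
    proof (cases "inv f = {}")
      case True
      then have "g \<sigma> \<le> g \<tau>" if "\<sigma> \<in> D" "\<tau> \<in> D" "f \<sigma> < f \<tau>" for \<sigma> \<tau>
        using that by (force simp: inv_def)
      with fg show ?thesis by (intro matched_within_comonotone[OF L D e]) blast+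
    next
      case False
      \<comment> \<open>For an inverted pair, the time at which the linear interpolations of its two
        values coincide.\<close>
      define c where "c = (\<lambda>(\<sigma>, \<tau>). (f \<tau> - f \<sigma>) / ((f \<tau> - f \<sigma>) + (g \<sigma> - g \<tau>)))"
      define t where "t = Min (c ` inv f)"
      define h where "h \<sigma> = (1 - t) * f \<sigma> + t * g \<sigma>" for \<sigma>
      have "t \<in> c ` inv f" unfolding t_def using fin False by (intro Min_in) auto
      then obtain \<alpha> \<beta> where ab: "(\<alpha>, \<beta>) \<in> inv f" and t: "t = c (\<alpha>, \<beta>)" by auto
      then have fab: "f \<alpha> < f \<beta>" "g \<beta> < g \<alpha>" by (auto simp: inv_def)
      then have t01: "0 < t" "t < 1" and tab: "t * ((f \<beta> - f \<alpha>) + (g \<alpha> - g \<beta>)) = f \<beta> - f \<alpha>"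
        by (auto simp: t c_def divide_simps)
      have hab: "h \<alpha> = h \<beta>" using tab by (simp add: h_def algebra_simps)
      \<comment> \<open>No strict inequality of \<open>f\<close> has been reversed by time
        \<open>t\<close>: non-inverted pairs keep their order along the segment, and inverted pairs
        cross no earlier than \<open>t\<close>.\<close>
      have fh: "h \<sigma> \<le> h \<tau>" if "\<sigma> \<in> D" "\<tau> \<in> D" "f \<sigma> < f \<tau>" for \<sigma> \<tau>
      proof (cases "g \<sigma> \<le> g \<tau>")
        case True
        then show ?thesis unfolding h_def using that t01 by (intro add_mono mult_left_mono) auto
      next
        case False
        with that have "(\<sigma>, \<tau>) \<in> inv f" by (auto simp: inv_def)
        then have "t \<le> c (\<sigma>, \<tau>)" unfolding t_def using fin by (intro Min_le) auto
        then have "t * ((f \<tau> - f \<sigma>) + (g \<sigma> - g \<tau>)) \<le> f \<tau> - f \<sigma>"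
          using that False by (simp add: c_def pos_le_divide_eq)
        then show ?thesis by (simp add: h_def algebra_simps)
      qed
      \<comment> \<open>Moving towards \<open>g\<close> creates no new inversions: if
        \<open>f\<close> and \<open>g\<close> both put \<open>\<tau>\<close> weakly below
        \<open>\<sigma>\<close>, so does \<open>h\<close>.\<close>
      have "inv h \<subseteq> inv f"
      proof
        fix x assume "x \<in> inv h"
        then obtain \<sigma> \<tau> where x: "x = (\<sigma>, \<tau>)" "\<sigma> \<in> D" "\<tau> \<in> D" "h \<sigma> < h \<tau>" "g \<tau> < g \<sigma>"
          by (auto simp: inv_def)
        have "f \<sigma> < f \<tau>"
        proof (rule ccontr)
          assume "\<not> f \<sigma> < f \<tau>"
          then have "h \<tau> \<le> h \<sigma>"
            unfolding h_def using x t01 by (intro add_mono mult_left_mono) auto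
          with x show False by simp
        qed
        with x show "x \<in> inv f" by (simp add: inv_def)
      qed
      moreover have "(\<alpha>, \<beta>) \<notin> inv h" using hab by (simp add: inv_def)
      ultimately have "card (inv h) < card (inv f)"
        using ab fin by (intro psubset_card_mono) auto
      moreover have "\<bar>h \<sigma> - g \<sigma>\<bar> \<le> (1 - t) * e" if "\<sigma> \<in> D" for \<sigma>
      proof -
        have "h \<sigma> - g \<sigma> = (1 - t) * (f \<sigma> - g \<sigma>)" by (simp add: h_def algebra_simps)
        then show ?thesis using fg[OF that] t01 by (simp add: abs_mult mult_left_mono)
      qed
      ultimately have "matched_within ((1 - t) * e) (dgm TYPE('k) i (\<lambda>r. {\<sigma>\<in>D. h \<sigma> \<le> r}))
           (dgm TYPE('k) i (\<lambda>r. {\<sigma>\<in>D. g \<sigma> \<le> r}))"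
        using e t01 by (intro less.hyps) auto
      moreover have "matched_within (t * e) (dgm TYPE('k) i (\<lambda>r. {\<sigma>\<in>D. f \<sigma> \<le> r}))
           (dgm TYPE('k) i (\<lambda>r. {\<sigma>\<in>D. h \<sigma> \<le> r}))"
      proof (rule matched_within_comonotone[OF L D])
        fix \<sigma> assume "\<sigma> \<in> D"
        have "f \<sigma> - h \<sigma> = t * (f \<sigma> - g \<sigma>)" by (simp add: h_def algebra_simps)
        then show "\<bar>f \<sigma> - h \<sigma>\<bar> \<le> t * e"
          using fg[OF \<open>\<sigma> \<in> D\<close>] t01 by (simp add: abs_mult mult_left_mono)
      qed (use e t01 fh in auto)
      \<comment> \<open>The costs of the two pieces, \<open>t * e\<close> and
        \<open>(1 - t) * e\<close>, add up to \<open>e\<close>.\<close>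
      ultimately show ?thesis
        using matched_within_trans by (fastforce simp: algebra_simps)
    qed
  qed
qed


section \<open>Flooding times\<close>

lemma infdist_le_iff_cball:
  fixes X :: "'a::metric_space set"
  assumes "finite X" "X \<noteq> {}"
  shows "infdist p X \<le> r \<longleftrightarrow> p \<in> (\<Union>x\<in>X. cball x r)"
proof -
  have "infdist p X = Min (dist p ` X)"
    using assms by (simp add: infdist_notempty cInf_eq_Min)
  then show ?thesis using assms by (auto simp: Min_le_iff dist_commute)
qed

lemma infdist_le_infdist_add_hausdorff_dist:
  fixes X X' :: "'a::metric_space set"
  assumes X: "finite X" "X \<noteq> {}" and X': "finite X'" "X' \<noteq> {}"
  shows "infdist p X \<le> infdist p X' + hausdorff_dist X X'"
proof -
  \<comment> \<open>Taking the radius \<open>infdist p X'\<close> itself yields a nearest point of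
    \<open>X'\<close>; the Hausdorff distance then bounds its distance to \<open>X\<close>.\<close>
  obtain x' where x': "x' \<in> X'" "dist x' p \<le> infdist p X'"
    using infdist_le_iff_cball[OF X', of p "infdist p X'"] by auto
  have "(MIN x\<in>X. dist x x') \<le> hausdorff_dist X X'"
    unfolding hausdorff_dist_def using x'(1) X' by (intro max.coboundedI2 Max_ge) auto
  moreover have "infdist x' X \<le> dist x x'" if "x \<in> X" for x
    using infdist_le[OF that, of x'] by (simp add: dist_commute)
  then have "infdist x' X \<le> (MIN x\<in>X. dist x x')"
    using X by auto
  ultimately show ?thesis
    using infdist_triangle[of p X x'] x'(2) by (simp add: dist_commute)
qed

text \<open>The time at which a simplex enters the flood filtration. For finite nonempty
  \<open>\<sigma>\<close> the hull is compact, so the supremum is over a bounded nonempty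
  set.\<close>

definition flood_time :: "'a::euclidean_space set \<Rightarrow> 'a set \<Rightarrow> real" where
  "flood_time X \<sigma> = (SUP p\<in>convex hull \<sigma>. infdist p X)"

lemma bdd_above_infdist_convex_hull:
  assumes "finite \<sigma>"
  shows "bdd_above ((\<lambda>p. infdist p X) ` (convex hull \<sigma> :: 'a::euclidean_space set))"
  by (intro bounded_imp_bdd_above compact_imp_bounded compact_continuous_image
      continuous_on_infdist continuous_on_id finite_imp_compact_convex_hull assms)

lemma flood_eq_sublevel:
  assumes X: "finite X" "X \<noteq> {}" and D: "\<And>\<sigma>. \<sigma> \<in> D \<Longrightarrow> finite \<sigma> \<and> \<sigma> \<noteq> {}"
  shows "flood X D r = {\<sigma>\<in>D. flood_time X \<sigma> \<le> r}"
proof -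
  have "flood_time X \<sigma> \<le> r \<longleftrightarrow> convex hull \<sigma> \<subseteq> (\<Union>x\<in>X. cball x r)" if "\<sigma> \<in> D" for \<sigma>
    unfolding flood_time_def using D[OF that]
    by (subst cSUP_le_iff)
      (simp_all add: bdd_above_infdist_convex_hull infdist_le_iff_cball[OF X] subset_eq del: UN_iff)
  then show ?thesis by (auto simp: flood_def)
qed

lemma flood_time_le:
  assumes X: "finite X" "X \<noteq> {}" and X': "finite X'" "X' \<noteq> {}" and \<sigma>: "finite \<sigma>" "\<sigma> \<noteq> {}"
  shows "flood_time X \<sigma> \<le> flood_time X' \<sigma> + hausdorff_dist X X'"
  unfolding flood_time_def
proof (rule cSUP_least)
  show "convex hull \<sigma> \<noteq> {}" using \<sigma> by simp
  fix p assume "p \<in> convex hull \<sigma>"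
  then have "infdist p X' \<le> (SUP p\<in>convex hull \<sigma>. infdist p X')"
    using \<sigma> by (intro cSUP_upper bdd_above_infdist_convex_hull)
  then show "infdist p X \<le> (SUP p\<in>convex hull \<sigma>. infdist p X') + hausdorff_dist X X'"
    using infdist_le_infdist_add_hausdorff_dist[OF X X', of p] by simp
qed

lemma hausdorff_dist_commute: "hausdorff_dist X X' = hausdorff_dist X' X"
  unfolding hausdorff_dist_def by (simp add: dist_commute max.commute)

theorem theorem2:
  fixes L X X' :: "'a::euclidean_space set"
    and D :: "'a set set"
    and i :: nat
  assumes "finite L" "L \<noteq> {}"
    and "finite X" "X \<noteq> {}"
    and "finite X'" "X' \<noteq> {}"
    and "delaunay_triangulation L D"
  shows "bottleneck (dgm TYPE('k::field) i (flood X D)) (dgm TYPE('k) i (flood X' D))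
           \<le> ereal (hausdorff_dist X X')"
proof -
  note X = assms(3,4) and X' = assms(5,6)
  have D: "\<sigma> \<noteq> {}" "\<sigma> \<subseteq> L" "finite \<sigma>" if "\<sigma> \<in> D" for \<sigma>
    using assms(1,7) that finite_subset by (auto simp: delaunay_triangulation_def)
  then have flood: "flood X D = (\<lambda>r. {\<sigma>\<in>D. flood_time X \<sigma> \<le> r})"
    "flood X' D = (\<lambda>r. {\<sigma>\<in>D. flood_time X' \<sigma> \<le> r})"
    using flood_eq_sublevel[OF X] flood_eq_sublevel[OF X'] by auto
  \<comment> \<open>Adding the two comparisons of distances at one point, once in each direction,
    shows that the Hausdorff distance is nonnegative.\<close>
  obtain x where "x \<in> X" using X by blast
  have "0 \<le> hausdorff_dist X X'"
  proof -
    have "infdist x X \<le> infdist x X' + hausdorff_dist X X'" "infdist x X' \<le> infdist x X + hausdorff_dist X X'"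
      using infdist_le_infdist_add_hausdorff_dist X X' hausdorff_dist_commute by metis+
    then show ?thesis by simp
  qed
  moreover have "\<bar>flood_time X \<sigma> - flood_time X' \<sigma>\<bar> \<le> hausdorff_dist X X'" if "\<sigma> \<in> D" for \<sigma>
    using flood_time_le[OF X X' D(3,1)[OF that]] flood_time_le[OF X' X D(3,1)[OF that]]
    by (simp add: hausdorff_dist_commute[of X'])
  ultimately show ?thesis
    unfolding flood
    using D(2) by (intro bottleneck_le_matched_within matched_within_sublevel[OF assms(1)]) blast+
qed

end
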